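(* Let $G=(N,E,w)$ be a weighted graph. If for all $\emptyset\neq S\subseteq N$ the $\tilde{\mathcal{P}}_{\min}$-restricted game of the unanimity game $(N,u_S)$ is convex, then the Reinforced Pan condition is satisfied by $G$.
   Context: $G=(N,E,w)$ is a finite simple undirected graph with vertex set $N$, edge set $E$ and weight function $w:E\to\mathbb{R}$; $w_k$ denotes $w(e_k)$. A game is a pair $(N,v)$ with $v:2^N\to\mathbb{R}$, $v(\emptyset)=0$. It is convex if $v(A\cup B)+v(A\cap B)\ge v(A)+v(B)$ for all $A,B\subseteq N$. The unanimity game is $u_S(A)=1$ if $A\supseteq S$ and $0$ otherwise. For $A\subseteq N$, $E(A)$ is the set of edges with both ends in $A$, $G_A=(A,E(A))$, and $\Sigma(A)$ is the set of minimum weight edges in $E(A)$ (empty if $E(A)=\emptyset$). $\mathcal{P}_{\min}(A)$ is the partition of $A$ into the connected components of $(A,E(A)\setminus\Sigma(A))$. If $A_1,\dots,A_p$ are the connected components of $G_A$, then $\tilde{\mathcal{P}}_{\min}(A)$ is the partition of $A$ whose blocks are all the blocks of $\mathcal{P}_{\min}(A_1),\dots,\mathcal{P}_{\min}(A_p)$. The $\tilde{\mathcal{P}}_{\min}$-restricted game of $(N,v)$ is the game $A\mapsto\sum_{F\in\tilde{\mathcal{P}}_{\min}(A)}v(F)$. Paths and cycles have distinct vertices; $V(\cdot)$ denotes vertex sets. A cycle is written $C=\{1,e_1,2,e_2,\dots,m,e_m,1\}$ with $e_k=\{k,k+1\}$ for $k<m$ and $e_m=\{m,1\}$; $\hat E(C)$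 is $E(C)=\{e_1,\dots,e_m\}$ together with all chords of $C$ in $G$. **Reinforced Pan condition.** For all connected subgraphs of $G$ that are the union of a cycle $C_m=\{1,e_1,2,\dots,m,e_m,1\}$ with $m\ge4$, labelled so that $w_1\le w_2\le w_3=\dots=w_m=\hat M=\max_{e\in\hat E(C_m)}w(e)$, and a path $P$ containing an edge $e$ with $w(e)<\hat M$ and with $V(C_m)\cap V(P)=\{2\}$: (a) if $w(e)<w_1$, then any vertex $j$ with $4\le j\le m$ is linked to (a vertex of) $P$ by an edge in $E$; (b) if $w(e)<w_1<\hat M$, then ($w_1=w_2$ and) any vertex $j$ with $4\le j\le m$ is linked to $2$ by an edge in $E$. *)

theory Defs
  imports Complex_Main
begin

text \<open>A simple undirected graph is a vertex set \<open>N\<close> with a set \<open>E\<close> of two-element subsets of \<open>N\<close>;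
  edge weights are given by \<open>w\<close>, whose values outside \<open>E\<close> are irrelevant.\<close>

definition fin_simple_graph :: "'a set \<Rightarrow> 'a set set \<Rightarrow> bool" where
  "fin_simple_graph N E \<longleftrightarrow> finite N \<and> (\<forall>e\<in>E. e \<subseteq> N \<and> card e = 2)"

definition induced_edges :: "'a set set \<Rightarrow> 'a set \<Rightarrow> 'a set set" where
  "induced_edges E A = {e \<in> E. e \<subseteq> A}"

definition min_edges :: "'a set set \<Rightarrow> ('a set \<Rightarrow> real) \<Rightarrow> 'a set \<Rightarrow> 'a set set" where
  "min_edges E w A = {e \<in> induced_edges E A. \<forall>f \<in> induced_edges E A. w e \<le> w f}"

definition connected_in :: "'a set \<Rightarrow> 'a set set \<Rightarrow> ('a \<times> 'a) set" where
  "connected_in A F = {(x, y). x \<in> A \<and> y \<in> A \<and> (x, y) \<in> {(a, b). {a, b} \<in> F}\<^sup>*}"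

text \<open>Vertex sets of the connected components of \<open>(A, F)\<close>, where \<open>F\<close> is a set of edges with both
  ends in \<open>A\<close>.\<close>

definition components_of :: "'a set \<Rightarrow> 'a set set \<Rightarrow> 'a set set" where
  "components_of A F = A // connected_in A F"

definition P_min :: "'a set set \<Rightarrow> ('a set \<Rightarrow> real) \<Rightarrow> 'a set \<Rightarrow> 'a set set" where
  "P_min E w A = components_of A (induced_edges E A - min_edges E w A)"

definition P_min_tilde :: "'a set set \<Rightarrow> ('a set \<Rightarrow> real) \<Rightarrow> 'a set \<Rightarrow> 'a set set" where
  "P_min_tilde E w A = (\<Union>K \<in> components_of A (induced_edges E A). P_min E w K)"

text \<open>A game on \<open>N\<close> is a function on all sets of which only the values on subsets of \<open>N\<close> matter.
  The normalisation \<open>v {} = 0\<close> is not imposed: it holds for every restricted game below, the empty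
  set having the empty partition.\<close>

definition convex_game :: "'a set \<Rightarrow> ('a set \<Rightarrow> real) \<Rightarrow> bool" where
  "convex_game N v \<longleftrightarrow>
    (\<forall>A B. A \<subseteq> N \<longrightarrow> B \<subseteq> N \<longrightarrow> v (A \<union> B) + v (A \<inter> B) \<ge> v A + v B)"

definition unanimity_game :: "'a set \<Rightarrow> 'a set \<Rightarrow> real" where
  "unanimity_game S A = (if S \<subseteq> A then 1 else 0)"

definition restricted_game :: "('a set \<Rightarrow> 'a set set) \<Rightarrow> ('a set \<Rightarrow> real) \<Rightarrow> 'a set \<Rightarrow> real" where
  "restricted_game P v A = (\<Sum>F \<in> P A. v F)"

text \<open>A cycle with \<open>m\<close> vertices is labelled by \<open>c :: nat \<Rightarrow> 'a\<close> on \<open>{1..m}\<close>; its \<open>k\<close>-th edge joins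
  \<open>c k\<close> to its successor, and the \<open>m\<close>-th edge closes the cycle.\<close>

definition cycle_edge :: "nat \<Rightarrow> (nat \<Rightarrow> 'a) \<Rightarrow> nat \<Rightarrow> 'a set" where
  "cycle_edge m c k = {c k, c (if k = m then 1 else k + 1)}"

definition cycle_edges :: "nat \<Rightarrow> (nat \<Rightarrow> 'a) \<Rightarrow> 'a set set" where
  "cycle_edges m c = cycle_edge m c ` {1..m}"

definition is_cycle :: "'a set \<Rightarrow> 'a set set \<Rightarrow> nat \<Rightarrow> (nat \<Rightarrow> 'a) \<Rightarrow> bool" where
  "is_cycle N E m c \<longleftrightarrow>
    3 \<le> m \<and> inj_on c {1..m} \<and> c ` {1..m} \<subseteq> N \<and> cycle_edges m c \<subseteq> E"

definition chords :: "'a set set \<Rightarrow> nat \<Rightarrow> (nat \<Rightarrow> 'a) \<Rightarrow> 'a set set" where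
  "chords E m c = {e \<in> E. e \<subseteq> c ` {1..m} \<and> e \<notin> cycle_edges m c}"

definition cycle_chord_edges :: "'a set set \<Rightarrow> nat \<Rightarrow> (nat \<Rightarrow> 'a) \<Rightarrow> 'a set set" where
  "cycle_chord_edges E m c = cycle_edges m c \<union> chords E m c"

definition path_edges :: "'a list \<Rightarrow> 'a set set" where
  "path_edges p = {{p ! i, p ! Suc i} |i. Suc i < length p}"

definition is_path :: "'a set \<Rightarrow> 'a set set \<Rightarrow> 'a list \<Rightarrow> bool" where
  "is_path N E p \<longleftrightarrow> p \<noteq> [] \<and> distinct p \<and> set p \<subseteq> N \<and> path_edges p \<subseteq> E"

text \<open>The union of the cycle and the path is automatically connected, as they share the vertex
  labelled \<open>2\<close>. This vertex need not be an end of the path.\<close>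

definition reinforced_pan_condition :: "'a set \<Rightarrow> 'a set set \<Rightarrow> ('a set \<Rightarrow> real) \<Rightarrow> bool" where
  "reinforced_pan_condition N E w \<longleftrightarrow>
    (\<forall>m c p e M w\<^sub>1 w\<^sub>2.
      is_cycle N E m c \<longrightarrow> 4 \<le> m \<longrightarrow>
      M = Max (w ` cycle_chord_edges E m c) \<longrightarrow>
      w\<^sub>1 = w (cycle_edge m c 1) \<longrightarrow> w\<^sub>2 = w (cycle_edge m c 2) \<longrightarrow>
      w\<^sub>1 \<le> w\<^sub>2 \<longrightarrow> w\<^sub>2 \<le> M \<longrightarrow> (\<forall>k\<in>{3..m}. w (cycle_edge m c k) = M) \<longrightarrow>
      is_path N E p \<longrightarrow> e \<in> path_edges p \<longrightarrow> w e < M \<longrightarrow>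
      c ` {1..m} \<inter> set p = {c 2} \<longrightarrow>
        (w e < w\<^sub>1 \<longrightarrow> (\<forall>j\<in>{4..m}. \<exists>x\<in>set p. {c j, x} \<in> E)) \<and>
        (w e < w\<^sub>1 \<and> w\<^sub>1 < M \<longrightarrow> w\<^sub>1 = w\<^sub>2 \<and> (\<forall>j\<in>{4..m}. {c j, c 2} \<in> E)))"

end

theory Submission
  imports Defs
begin

text \<open>Write \<open>x \<sim>\<^sub>A y\<close> when \<open>x\<close> and \<open>y\<close> lie in a common block of the partition of \<open>A\<close>. Convexity for the
  unanimity games of the sets \<open>{x, y}\<close> says that \<open>\<sim>\<^sub>A\<close> grows with \<open>A\<close> and that \<open>x \<sim>\<^sub>A y\<close> and \<open>x \<sim>\<^sub>B y\<close>
  imply \<open>x \<sim> y\<close> in \<open>A \<inter> B\<close>. For (a), \<open>j \<sim> 2\<close> holds in the union of \<open>P\<close> with either arc of the cycle from \<open>2\<close>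
  to \<open>j\<close>, since no edge of an arc is of minimum weight there; hence it holds in \<open>P \<union> {j}\<close>, and \<open>j\<close> is
  linked to \<open>P\<close>. For (b), the vertices other than \<open>2\<close> are equivalent in \<open>V(C)\<close>. As \<open>1 \<sim> 2\<close> in
  \<open>P \<union> {1}\<close> but not in \<open>{1, 2}\<close>, it fails in \<open>V(C)\<close>, which forces \<open>w\<^sub>1 = w\<^sub>2\<close>. If \<open>j\<close> is not linked to \<open>2\<close>,
  shrink \<open>P\<close> to a path starting at \<open>2\<close>. Then \<open>1 \<sim> j\<close> holds in \<open>V(C)\<close> and in \<open>P \<union> {1, j}\<close>, hence in
  \<open>{1, 2, j}\<close>, so that \<open>{1, j}\<close> is an edge; by its weight \<open>1 \<sim> j\<close> also holds in \<open>P \<union> {1, j}\<close> without \<open>2\<close>,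
  hence in \<open>{1, j}\<close>, which is absurd.\<close>

section \<open>Common blocks as a relation between vertices\<close>

definition same_block :: "'a set set \<Rightarrow> ('a set \<Rightarrow> real) \<Rightarrow> 'a set \<Rightarrow> 'a \<Rightarrow> 'a \<Rightarrow> bool" where
  "same_block E w A x y \<longleftrightarrow> (\<exists>F\<in>P_min_tilde E w A. x \<in> F \<and> y \<in> F)"

definition connected_set :: "'a set set \<Rightarrow> 'a set \<Rightarrow> bool" where
  "connected_set E A \<longleftrightarrow> (\<forall>x\<in>A. \<forall>y\<in>A. (x, y) \<in> connected_in A (induced_edges E A))"

lemma adj_rtrancl_sym:
  assumes "(x, y) \<in> {(a, b). {a, b} \<in> F}\<^sup>*"
  shows "(y, x) \<in> {(a, b). {a, b} \<in> F}\<^sup>*"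
proof -
  have "sym {(a, b). {a, b} \<in> F}"
    by (auto simp: sym_def insert_commute)
  then show ?thesis
    using assms sym_rtrancl symD by fast
qed

lemma connected_in_equiv: "equiv A (connected_in A F)"
proof (rule equivI)
  show "connected_in A F \<subseteq> A \<times> A" "refl_on A (connected_in A F)"
    by (auto simp: connected_in_def refl_on_def)
  show "sym (connected_in A F)"
    by (auto simp: connected_in_def sym_def intro: adj_rtrancl_sym)
  show "trans (connected_in A F)"
    by (auto simp: connected_in_def trans_def)
qed

lemma connected_in_mono:
  "A \<subseteq> B \<Longrightarrow> F \<subseteq> G \<Longrightarrow> connected_in A F \<subseteq> connected_in B G"
  unfolding connected_in_def using rtrancl_mono[of "{(a, b). {a, b} \<in> F}" "{(a, b). {a, b} \<in> G}"]
  by auto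

lemma components_of_subset: "K \<in> components_of A F \<Longrightarrow> K \<subseteq> A"
  unfolding components_of_def using connected_in_equiv in_quotient_imp_subset by metis

lemma components_of_unique:
  assumes "K \<in> components_of A F" "L \<in> components_of A F" "x \<in> K" "x \<in> L"
  shows "K = L"
  using assms quotient_disj[OF connected_in_equiv] unfolding components_of_def by fast

lemma P_min_tilde_subset: "F \<in> P_min_tilde E w A \<Longrightarrow> F \<subseteq> A"
  unfolding P_min_tilde_def P_min_def using components_of_subset by blast

text \<open>Blocks sharing \<open>x\<close> lie in components of the graph induced on
  \<open>A\<close> that share \<open>x\<close>, hence in one component, where they are classes of a
  single equivalence relation.\<close>

lemma P_min_tilde_unique:
  assumes "F \<in> P_min_tilde E w A" "G \<in> P_min_tilde E w A" "x \<in> F" "x \<in> G"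
  shows "F = G"
  using assms unfolding P_min_tilde_def P_min_def
  by (smt (verit, best) UN_E components_of_subset components_of_unique subsetD)

lemma same_block_in: "same_block E w A x y \<Longrightarrow> x \<in> A \<and> y \<in> A"
  unfolding same_block_def using P_min_tilde_subset by blast

lemma same_block_sym: "same_block E w A x y \<Longrightarrow> same_block E w A y x"
  unfolding same_block_def by blast

lemma same_block_trans:
  "same_block E w A x y \<Longrightarrow> same_block E w A y z \<Longrightarrow> same_block E w A x z"
  unfolding same_block_def using P_min_tilde_unique by metis

text \<open>Blocks are disjoint, so at most one of them contains both vertices. This turns convexity
  into a statement about \<open>same_block\<close>.\<close>

lemma restricted_unanimity_pair:
  assumes "finite A"
  shows "restricted_game (P_min_tilde E w) (unanimity_game {x, y}) A =
    (if same_block E w A x y then 1 else 0)"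
proof -
  let ?P = "P_min_tilde E w A"
  have "?P \<subseteq> Pow A"
    using P_min_tilde_subset by blast
  then have fin: "finite ?P"
    using assms finite_subset by blast
  show ?thesis
  proof (cases "same_block E w A x y")
    case True
    then obtain F where F: "F \<in> ?P" "x \<in> F" "y \<in> F"
      unfolding same_block_def by blast
    have "unanimity_game {x, y} G = (if G = F then 1 else 0)" if "G \<in> ?P" for G
      using F P_min_tilde_unique[OF that F(1)] by (auto simp: unanimity_game_def)
    then have "restricted_game (P_min_tilde E w) (unanimity_game {x, y}) A
        = (\<Sum>G\<in>?P. if G = F then 1 else 0)"
      unfolding restricted_game_def by (intro sum.cong) auto
    then show ?thesis
      using True F fin by simp
  next
    case False
    then show ?thesis
      unfolding restricted_game_def unanimity_game_def same_block_def
      by (auto intro!: sum.neutral)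
  qed
qed

section \<open>Surviving edges and common blocks\<close>

text \<open>A connected \<open>A\<close> is its own component. The weight of \<open>g\<close> bounds
  the minimum weight in \<open>A\<close> from above, so every edge in \<open>D\<close> survives the
  deletion of the minimum weight edges.\<close>

lemma same_blockI:
  assumes "connected_set E A" "g \<in> E" "g \<subseteq> A" "x \<in> A"
    and D: "\<And>f. f \<in> D \<Longrightarrow> f \<in> E \<and> f \<subseteq> A \<and> w g < w f"
    and xy: "(x, y) \<in> {(a, b). {a, b} \<in> D}\<^sup>*"
  shows "same_block E w A x y"
proof -
  let ?F = "induced_edges E A - min_edges E w A"
  have "connected_in A (induced_edges E A) `` {x} = A"
    using assms(1,4) unfolding connected_set_def connected_in_def by auto
  then have A: "A \<in> components_of A (induced_edges E A)"
    unfolding components_of_def using quotientI[OF \<open>x \<in> A\<close>] by metis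
  have "D \<subseteq> ?F"
    using D assms(2,3) by (force simp: induced_edges_def min_edges_def)
  then have "(x, y) \<in> {(a, b). {a, b} \<in> ?F}\<^sup>*"
    using xy rtrancl_mono[of "{(a, b). {a, b} \<in> D}" "{(a, b). {a, b} \<in> ?F}"] by blast
  moreover have "y \<in> A"
    using xy \<open>x \<in> A\<close> D by (induction rule: rtrancl_induct) auto
  ultimately have "y \<in> connected_in A ?F `` {x}" "x \<in> connected_in A ?F `` {x}"
    using \<open>x \<in> A\<close> by (auto simp: connected_in_def)
  moreover have "connected_in A ?F `` {x} \<in> P_min E w A"
    unfolding P_min_def components_of_def using \<open>x \<in> A\<close> by (rule quotientI)
  ultimately show ?thesis
    unfolding same_block_def P_min_tilde_def using A by blast
qed

lemma interval_rtrancl: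
  fixes f :: "nat \<Rightarrow> 'a"
  assumes "\<And>k. a \<le> k \<Longrightarrow> k < b \<Longrightarrow> {f k, f (Suc k)} \<in> F" and "a \<le> b"
  shows "(f a, f b) \<in> {(x, y). {x, y} \<in> F}\<^sup>*"
  using \<open>a \<le> b\<close> assms(1)
proof (induction rule: dec_induct)
  case base
  show ?case by simp
next
  case (step n)
  then have "(f a, f n) \<in> {(x, y). {x, y} \<in> F}\<^sup>*" "{f n, f (Suc n)} \<in> F"
    by auto
  then show ?case
    by (simp add: rtrancl.rtrancl_into_rtrancl)
qed

lemma same_block_interval:
  fixes f :: "nat \<Rightarrow> 'a"
  assumes "connected_set E A" "g \<in> E" "g \<subseteq> A" "f ` {a..b} \<subseteq> A" "a \<le> b"
    and e: "\<And>k. a \<le> k \<Longrightarrow> k < b \<Longrightarrow> {f k, f (Suc k)} \<in> E \<and> w g < w {f k, f (Suc k)}"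
  shows "same_block E w A (f a) (f b)"
proof (rule same_blockI[OF assms(1-3)])
  show "f a \<in> A"
    using assms(4,5) by auto
  show "(f a, f b) \<in> {(x, y). {x, y} \<in> {h. h \<in> E \<and> h \<subseteq> A \<and> w g < w h}}\<^sup>*"
    using assms(4,5) e by (intro interval_rtrancl) auto
qed auto

lemma same_block_edge:
  assumes "connected_set E A" "g \<in> E" "g \<subseteq> A" "{x, y} \<in> E" "{x, y} \<subseteq> A" "w g < w {x, y}"
  shows "same_block E w A x y"
  using assms by (intro same_blockI[where g = g and D = "{{x, y}}"]) auto

text \<open>A walk from \<open>x\<close> to \<open>y\<close> inside their block uses surviving edges
  only. Its first edge is not of minimum weight in its component, so a lighter \<open>g\<close>
  exists there. This covers disconnected \<open>A\<close> too.\<close>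

lemma same_block_leaving_edge:
  assumes "same_block E w A x y" "x \<noteq> y"
  obtains z g where "{x, z} \<in> E" "z \<in> A" "g \<in> E" "g \<subseteq> A" "w g < w {x, z}"
proof -
  from assms(1) obtain K x' where K: "K \<subseteq> A"
    and "x \<in> connected_in K (induced_edges E K - min_edges E w K) `` {x'}"
    and "y \<in> connected_in K (induced_edges E K - min_edges E w K) `` {x'}"
    unfolding same_block_def P_min_tilde_def P_min_def
    by (smt (verit) UN_E components_of_def components_of_subset quotientE)
  then have "(x, y) \<in> connected_in K (induced_edges E K - min_edges E w K)"
    using connected_in_equiv[of K] by (meson Image_singleton_iff equivE symE transE)
  then have "(x, y) \<in> {(a, b). {a, b} \<in> induced_edges E K - min_edges E w K}\<^sup>*"
    by (simp add: connected_in_def)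
  then obtain z where "{x, z} \<in> induced_edges E K - min_edges E w K"
    using assms(2) by (cases rule: converse_rtranclE) auto
  then show thesis
    using K that[of z] by (force simp: induced_edges_def min_edges_def)
qed

section \<open>Connected vertex sets\<close>

lemma connected_set_interval:
  fixes f :: "nat \<Rightarrow> 'a"
  assumes "\<And>k. a \<le> k \<Longrightarrow> k < b \<Longrightarrow> {f k, f (Suc k)} \<in> E"
  shows "connected_set E (f ` {a..b})"
proof -
  let ?A = "f ` {a..b}"
  have from_a: "(f a, f k) \<in> {(x, y). {x, y} \<in> induced_edges E ?A}\<^sup>*" if "a \<le> k" "k \<le> b" for k
    using assms that by (intro interval_rtrancl) (auto simp: induced_edges_def)
  have "(f k, f l) \<in> {(x, y). {x, y} \<in> induced_edges E ?A}\<^sup>*"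
    if "a \<le> k" "k \<le> b" "a \<le> l" "l \<le> b" for k l
    using rtrancl_trans[OF adj_rtrancl_sym[OF from_a[of k]] from_a[of l]] that by simp
  then show ?thesis
    by (auto simp: connected_set_def connected_in_def)
qed

lemma connected_set_edge:
  assumes "{x, y} \<in> E"
  shows "connected_set E {x, y}"
proof -
  \<comment> \<open>An edge is viewed as a path indexed by 0 and 1.\<close>
  have "connected_set E ((\<lambda>k. if k = 0 then x else y) ` {0..1::nat})"
    by (rule connected_set_interval) (use assms in auto)
  moreover have "(\<lambda>k. if k = 0 then x else y) ` {0..1::nat} = {x, y}"
    by (auto simp: image_iff intro: bexI[of _ 1])
  ultimately show ?thesis
    by simp
qed

lemma connected_set_Un:
  assumes "connected_set E A" "connected_set E B" "z \<in> A" "z \<in> B"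
  shows "connected_set E (A \<union> B)"
proof -
  let ?R = "connected_in (A \<union> B) (induced_edges E (A \<union> B))"
  have "(x, z) \<in> ?R" if "x \<in> A \<union> B" for x
  proof -
    have "(x, z) \<in> connected_in A (induced_edges E A) \<union> connected_in B (induced_edges E B)"
      using that assms by (auto simp: connected_set_def)
    moreover have "connected_in A (induced_edges E A) \<subseteq> ?R" "connected_in B (induced_edges E B) \<subseteq> ?R"
      by (rule connected_in_mono; auto simp: induced_edges_def)+
    ultimately show ?thesis by blast
  qed
  then show ?thesis
    unfolding connected_set_def using connected_in_equiv[of "A \<union> B" "induced_edges E (A \<union> B)"]
    by (meson equivE symE transE)
qed

text \<open>Cuts the path at \<open>x\<close>: \<open>T\<close> is the stretch from a neighbour
  \<open>q\<close> of \<open>x\<close> up to and including \<open>e\<close>.\<close>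

lemma path_connected_part:
  assumes "is_path N E p" "e \<in> path_edges p" "x \<in> set p" "x \<notin> e"
  obtains T q where "T \<subseteq> set p" "x \<notin> T" "connected_set E T" "e \<subseteq> T" "q \<in> T" "{x, q} \<in> E"
proof -
  obtain a where a: "e = {p ! a, p ! Suc a}" "Suc a < length p"
    using assms(2) by (auto simp: path_edges_def)
  obtain i where i: "x = p ! i" "i < length p"
    using assms(3) by (metis in_set_conv_nth)
  have dist: "distinct p" and edge: "\<And>k. Suc k < length p \<Longrightarrow> {p ! k, p ! Suc k} \<in> E"
    using assms(1) by (auto simp: is_path_def path_edges_def)
  have T: "(!) p ` {l..h} \<subseteq> set p" "connected_set E ((!) p ` {l..h})"
    "x \<notin> (!) p ` {l..h}" if "h < length p" "i \<notin> {l..h}" for l h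
  proof -
    show "(!) p ` {l..h} \<subseteq> set p" "connected_set E ((!) p ` {l..h})"
      using that edge by (auto intro!: connected_set_interval)
    show "x \<notin> (!) p ` {l..h}"
      using that i dist by (auto simp: nth_eq_iff_index_eq)
  qed
  \<comment> \<open>As \<open>x\<close> is not an end of \<open>e\<close>, its position
    \<open>i\<close> is neither \<open>a\<close> nor \<open>Suc a\<close>.\<close>
  consider "i < a" | "Suc a < i"
    using a i assms(4) by (metis insertI1 insertI2 linorder_neqE_nat not_less_eq)
  then show thesis
  proof cases
    case 1
    then show thesis
      using a i edge[of i]
      by (intro that[of "(!) p ` {Suc i..Suc a}" "p ! Suc i"] T) auto
  next
    case 2
    then show thesis
      using a i edge[of "i - 1"]
      by (intro that[of "(!) p ` {a..i - 1}" "p ! (i - 1)"] T) (auto simp: insert_commute)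
  qed
qed

text \<open>Continues the labelling of a cycle beyond \<open>m\<close>, so that the arc from \<open>j\<close> through \<open>m\<close> and \<open>1\<close> to
  \<open>2\<close> is the interval from \<open>j\<close> to \<open>m + 2\<close>.\<close>

definition unroll :: "nat \<Rightarrow> (nat \<Rightarrow> 'a) \<Rightarrow> nat \<Rightarrow> 'a" where
  "unroll m c k = (if k \<le> m then c k else c (k - m))"

section \<open>Consequences of convexity for pairs of vertices\<close>

locale convexity_inheriting_graph =
  fixes N :: "'a set" and E :: "'a set set" and w :: "'a set \<Rightarrow> real"
  assumes graph: "fin_simple_graph N E"
    and convex: "\<And>S. S \<noteq> {} \<Longrightarrow> S \<subseteq> N \<Longrightarrow>
      convex_game N (restricted_game (P_min_tilde E w) (unanimity_game S))"
begin

lemma no_loop: "{x, x} \<notin> E"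
  using graph by (auto simp: fin_simple_graph_def)

lemma same_block_supermodular:
  assumes "A \<subseteq> N" "B \<subseteq> N" "x \<in> N" "y \<in> N"
  shows "of_bool (same_block E w A x y) + of_bool (same_block E w B x y)
    \<le> (of_bool (same_block E w (A \<union> B) x y) + of_bool (same_block E w (A \<inter> B) x y) :: real)"
proof -
  have "finite N"
    using graph by (simp add: fin_simple_graph_def)
  then have "finite A" "finite B"
    using assms finite_subset by blast+
  then have "finite (A \<union> B)" "finite (A \<inter> B)"
    by auto
  have "convex_game N (restricted_game (P_min_tilde E w) (unanimity_game {x, y}))"
    using assms by (intro convex) auto
  then have "restricted_game (P_min_tilde E w) (unanimity_game {x, y}) A +
      restricted_game (P_min_tilde E w) (unanimity_game {x, y}) B
    \<le> restricted_game (P_min_tilde E w) (unanimity_game {x, y}) (A \<union> B) +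
      restricted_game (P_min_tilde E w) (unanimity_game {x, y}) (A \<inter> B)"
    using assms unfolding convex_game_def by simp
  then show ?thesis
    unfolding of_bool_def using \<open>finite A\<close> \<open>finite B\<close> \<open>finite (A \<union> B)\<close> \<open>finite (A \<inter> B)\<close>
    by (simp only: restricted_unanimity_pair)
qed

lemma same_block_Int:
  assumes "same_block E w A x y" "same_block E w B x y" "A \<subseteq> N" "B \<subseteq> N"
  shows "same_block E w (A \<inter> B) x y"
proof -
  have "x \<in> N" "y \<in> N"
    using same_block_in[OF assms(1)] assms(3) by auto
  from same_block_supermodular[OF assms(3,4) this] show ?thesis
    using assms(1,2) by (simp split: split_of_bool_asm)
qed

text \<open>Supermodularity for \<open>A\<close> and \<open>B - A\<close>: no vertices are
  equivalent in their empty intersection, so the 1 contributed by \<open>A\<close> must reappear at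
  their union \<open>B\<close>.\<close>

lemma same_block_mono:
  assumes "same_block E w A x y" "A \<subseteq> B" "B \<subseteq> N"
  shows "same_block E w B x y"
proof -
  have "\<not> same_block E w {} x y"
    using same_block_in by fastforce
  moreover have "A \<union> (B - A) = B" "A \<inter> (B - A) = {}"
    using assms(2) by auto
  moreover have "A \<subseteq> N" "B - A \<subseteq> N" "x \<in> N" "y \<in> N"
    using same_block_in[OF assms(1)] assms(2,3) by auto
  ultimately show ?thesis
    using same_block_supermodular[of A "B - A" x y] assms(1) by (auto split: split_of_bool_asm)
qed

text \<open>The edge leaving \<open>x\<close> would have to be \<open>{x, y}\<close>, and the only
  candidate for a lighter edge is \<open>{x, y}\<close> again.\<close>

lemma not_same_block_pair:
  assumes "x \<noteq> y"
  shows "\<not> same_block E w {x, y} x y"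
proof
  assume "same_block E w {x, y} x y"
  then obtain z g where z: "{x, z} \<in> E" "z \<in> {x, y}" "g \<in> E" "g \<subseteq> {x, y}" "w g < w {x, z}"
    using assms by (rule same_block_leaving_edge)
  then have "z = y"
    using no_loop by auto
  moreover have "card g = 2"
    using z graph by (auto simp: fin_simple_graph_def)
  then have "g = {x, y}"
    using z(4) assms by (intro card_subset_eq) auto
  ultimately show False
    using z(5) by simp
qed

lemma edge_eq: "g \<in> E \<Longrightarrow> g \<subseteq> {x, y, z} \<Longrightarrow> g = {x, y} \<or> g = {x, z} \<or> g = {y, z}"
proof -
  assume g: "g \<in> E" "g \<subseteq> {x, y, z}"
  then obtain a b where "g = {a, b}" "a \<noteq> b"
    using graph by (metis card_2_iff fin_simple_graph_def)
  then show ?thesis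
    using g by auto
qed

text \<open>Both \<open>x\<close> and \<open>z\<close> can be left only towards \<open>y\<close>, so
  each of the two possible edges would have to be heavier than the other.\<close>

lemma not_same_block_two_edge_path:
  assumes "x \<noteq> z" "{x, z} \<notin> E"
  shows "\<not> same_block E w {x, y, z} x z"
proof
  assume R: "same_block E w {x, y, z} x z"
  have edges: "g = {x, y} \<or> g = {z, y}" if "g \<in> E" "g \<subseteq> {x, y, z}" for g
    using edge_eq[OF that] that assms(2) by (auto simp: insert_commute)
  obtain a g where a: "{x, a} \<in> E" "a \<in> {x, y, z}" "g \<in> E" "g \<subseteq> {x, y, z}" "w g < w {x, a}"
    using R assms(1) by (rule same_block_leaving_edge)
  obtain b h where b: "{z, b} \<in> E" "b \<in> {x, y, z}" "h \<in> E" "h \<subseteq> {x, y, z}" "w h < w {z, b}"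
    using same_block_sym[OF R] assms(1) by (metis same_block_leaving_edge)
  have "a = y" "b = y"
    using a b assms no_loop by (auto simp: insert_commute)
  moreover have "w g = w {x, y} \<or> w g = w {z, y}" "w h = w {x, y} \<or> w h = w {z, y}"
    using edges a b by metis+
  ultimately show False
    using a(5) b(5) by auto
qed

section \<open>Cycles and their arcs\<close>

lemma unroll_edge:
  assumes "is_cycle N E m c" "1 \<le> k" "k \<le> Suc m"
  shows "{unroll m c k, unroll m c (Suc k)} = cycle_edge m c (if k \<le> m then k else 1)"
proof -
  \<comment> \<open>The index \<open>Suc m\<close> stands for the edge from \<open>c 1\<close> to
    \<open>c 2\<close>, the last one on an arc ending at \<open>m + 2\<close>.\<close>
  consider "k < m" | "k = m" | "k = Suc m"
    using assms(3) by linarith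
  then show ?thesis
    using assms(1) by cases (auto simp: unroll_def cycle_edge_def is_cycle_def Suc_diff_le)
qed

lemma cycle_edge_in: "is_cycle N E m c \<Longrightarrow> k \<in> {1..m} \<Longrightarrow> cycle_edge m c k \<in> E"
  by (auto simp: is_cycle_def cycle_edges_def)

lemma cycle_edge_1: "is_cycle N E m c \<Longrightarrow> cycle_edge m c 1 = {c 1, c 2}"
  by (simp add: is_cycle_def cycle_edge_def numeral_2_eq_2)

lemma cycle_connected:
  assumes "is_cycle N E m c"
  shows "connected_set E (c ` {1..m})"
proof (rule connected_set_interval)
  fix k assume "1 \<le> k" "k < m"
  then show "{c k, c (Suc k)} \<in> E"
    using cycle_edge_in[OF assms, of k] by (simp add: cycle_edge_def)
qed

text \<open>From here on, the connected set \<open>T\<close> plays the role of the vertex set of the path,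
  without the vertex \<open>2\<close> in the lemma on chords.\<close>

lemma same_block_cycle_vertex:
  assumes cyc: "is_cycle N E m c" and j: "2 \<le> j" "j \<le> m"
    and T: "T \<subseteq> N" "connected_set E T" "e \<in> E" "e \<subseteq> T"
    and cT: "c ` {1..m} \<inter> T = {c 2}"
    and we: "\<And>k. k \<in> {1..m} \<Longrightarrow> w e < w (cycle_edge m c k)"
  shows "same_block E w (insert (c j) T) (c j) (c 2)"
proof -
  let ?u = "unroll m c"
  have m: "3 \<le> m" and inj: "inj_on c {1..m}" and cN: "c ` {1..m} \<subseteq> N"
    using cyc by (auto simp: is_cycle_def)
  have c2: "c 2 \<in> T"
    using cT by auto
  have u2: "?u 2 = c 2" "?u (m + 2) = c 2" "?u (Suc m) = c 1" and uj: "?u j = c j"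
    using m j by (auto simp: unroll_def)
  have edge: "{?u k, ?u (Suc k)} \<in> E \<and> w e < w {?u k, ?u (Suc k)}" if "1 \<le> k" "k \<le> Suc m" for k
    using that m unroll_edge[OF cyc that] cycle_edge_in[OF cyc] we by auto
  have im1: "?u ` {2..j} = c ` {2..j}"
    using j by (intro image_cong) (auto simp: unroll_def)
  have "{j..m + 2} = insert (m + 2) (insert (Suc m) {j..m})"
    using j by auto
  moreover have "?u ` {j..m} = c ` {j..m}"
    by (intro image_cong) (auto simp: unroll_def)
  ultimately have im2: "?u ` {j..m + 2} = insert (c 2) (insert (c 1) (c ` {j..m}))"
    using u2 by simp
  \<comment> \<open>The arc meets \<open>T\<close> in \<open>c 2\<close>, so the union is connected,
    and \<open>e\<close> is lighter than every edge of the arc.\<close>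
  have arc: "same_block E w (T \<union> ?u ` {a..b}) (?u a) (?u b)"
    if "1 \<le> a" "a \<le> b" "b \<le> m + 2" "c 2 \<in> ?u ` {a..b}" for a b
  proof (rule same_block_interval[OF _ T(3)])
    show "connected_set E (T \<union> ?u ` {a..b})"
      using edge that c2 by (intro connected_set_Un[OF T(2) _ c2] connected_set_interval) auto
    show "{?u k, ?u (Suc k)} \<in> E \<and> w e < w {?u k, ?u (Suc k)}" if "a \<le> k" "k < b" for k
      using edge[of k] that \<open>1 \<le> a\<close> \<open>b \<le> m + 2\<close> by simp
  qed (use that T in auto)
  have "same_block E w (T \<union> c ` {2..j}) (c j) (c 2)"
    using arc[of 2 j] j im1 u2 uj by (auto intro: same_block_sym)
  moreover have "same_block E w (T \<union> ?u ` {j..m + 2}) (c j) (c 2)"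
    using arc[of j "m + 2"] j im2 u2 uj by auto
  ultimately have "same_block E w ((T \<union> c ` {2..j}) \<inter> (T \<union> ?u ` {j..m + 2})) (c j) (c 2)"
    using T(1) cN j m im2 by (intro same_block_Int) auto
  \<comment> \<open>The two arcs between \<open>c 2\<close> and \<open>c j\<close> share only their
    ends, and \<open>c 2\<close> is in \<open>T\<close>; so nothing outside \<open>T\<close> remains
    but \<open>c j\<close>.\<close>
  moreover have "(T \<union> c ` {2..j}) \<inter> (T \<union> ?u ` {j..m + 2}) = insert (c j) T"
  proof -
    have "c ` {2..j} \<inter> c ` {j..m} = c ` ({2..j} \<inter> {j..m})"
      using inj j by (subst inj_on_image_Int[of c "{1..m}"]) auto
    then have "c ` {2..j} \<inter> c ` {j..m} = {c j}"
      using j by simp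
    moreover have "c 1 \<notin> c ` {2..j}"
      using inj j by (auto dest: inj_onD)
    ultimately show ?thesis
      using c2 unfolding im2 by auto
  qed
  ultimately show ?thesis
    by simp
qed

section \<open>Links required by (a)\<close>

text \<open>Equivalence of \<open>c j\<close> and \<open>c 2\<close> in
  \<open>insert (c j) T\<close> needs an edge leaving \<open>c j\<close> there; not being a loop, it
  ends in \<open>T\<close>.\<close>

lemma pan_linked:
  assumes cyc: "is_cycle N E m c" and j: "3 \<le> j" "j \<le> m"
    and T: "T \<subseteq> N" "connected_set E T" "e \<in> E" "e \<subseteq> T"
    and cT: "c ` {1..m} \<inter> T = {c 2}"
    and we: "\<And>k. k \<in> {1..m} \<Longrightarrow> w e < w (cycle_edge m c k)"
  shows "\<exists>x\<in>T. {c j, x} \<in> E"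
proof -
  have "c j \<noteq> c 2"
    using cyc j by (auto simp: is_cycle_def dest: inj_onD)
  moreover have "same_block E w (insert (c j) T) (c j) (c 2)"
    using same_block_cycle_vertex[OF cyc _ j(2) T cT we] j by simp
  ultimately obtain z where "{c j, z} \<in> E" "z \<in> insert (c j) T"
    by (metis same_block_leaving_edge)
  then show ?thesis
    using no_loop by auto
qed

section \<open>Weights and chords required by (b)\<close>

text \<open>The arc from \<open>c j\<close> through \<open>c m\<close> to \<open>c 1\<close> uses
  only edges numbered \<open>j\<close> to \<open>m\<close>, all heavier than the first edge of the
  cycle.\<close>

lemma same_block_cycle:
  assumes cyc: "is_cycle N E m c" and j: "3 \<le> j" "j \<le> m"
    and M: "\<And>k. k \<in> {3..m} \<Longrightarrow> w (cycle_edge m c 1) < w (cycle_edge m c k)"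
  shows "same_block E w (c ` {1..m}) (c 1) (c j)"
proof -
  let ?u = "unroll m c"
  have "same_block E w (c ` {1..m}) (?u j) (?u (Suc m))"
  proof (rule same_block_interval[OF cycle_connected[OF cyc]])
    show "cycle_edge m c 1 \<in> E"
      using cycle_edge_in[OF cyc] j by simp
    show "{?u k, ?u (Suc k)} \<in> E \<and> w (cycle_edge m c 1) < w {?u k, ?u (Suc k)}"
      if "j \<le> k" "k < Suc m" for k
      using that j unroll_edge[OF cyc, of k] cycle_edge_in[OF cyc, of k] M[of k] by simp
    show "?u ` {j..Suc m} \<subseteq> c ` {1..m}"
      using j by (auto simp: unroll_def le_Suc_eq)
  qed (use j in \<open>auto simp: cycle_edge_def\<close>)
  then show ?thesis
    using j by (simp add: unroll_def same_block_sym)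
qed

lemma same_block_first_edge:
  assumes cyc: "is_cycle N E m c"
    and T: "connected_set E T" "e \<in> E" "e \<subseteq> T" "c 2 \<in> T"
    and we: "w e < w (cycle_edge m c 1)"
  shows "same_block E w (insert (c 1) T) (c 1) (c 2)"
proof (rule same_block_edge[OF _ T(2)])
  have "cycle_edge m c 1 = {c 1, c 2}" "cycle_edge m c 1 \<in> E"
    using cycle_edge_1[OF cyc] cycle_edge_in[OF cyc, of 1] cyc by (auto simp: is_cycle_def)
  then show edge: "{c 1, c 2} \<in> E" and "w e < w {c 1, c 2}"
    using we by auto
  have "connected_set E ({c 1, c 2} \<union> T)"
    by (rule connected_set_Un[OF connected_set_edge[OF edge] T(1)]) (use T in auto)
  then show "connected_set E (insert (c 1) T)"
    using T(4) by (simp add: insert_absorb)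
qed (use T in auto)

text \<open>Were the second edge heavier than the first, it would survive in the cycle and make
  \<open>c 2\<close> equivalent to \<open>c 3\<close>, hence to \<open>c 1\<close>. Intersecting
  with \<open>insert (c 1) T\<close> leaves \<open>{c 1, c 2}\<close>, where the two are
  separated.\<close>

lemma pan_weights_eq:
  assumes cyc: "is_cycle N E m c"
    and T: "T \<subseteq> N" "connected_set E T" "e \<in> E" "e \<subseteq> T"
    and cT: "c ` {1..m} \<inter> T = {c 2}"
    and we: "w e < w (cycle_edge m c 1)"
    and w12: "w (cycle_edge m c 1) \<le> w (cycle_edge m c 2)"
    and M: "\<And>k. k \<in> {3..m} \<Longrightarrow> w (cycle_edge m c 1) < w (cycle_edge m c k)"
  shows "w (cycle_edge m c 1) = w (cycle_edge m c 2)"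
proof (rule ccontr)
  let ?X = "c ` {1..m}"
  assume "w (cycle_edge m c 1) \<noteq> w (cycle_edge m c 2)"
  then have less: "w (cycle_edge m c 1) < w (cycle_edge m c 2)"
    using w12 by simp
  have m: "3 \<le> m" and inj: "inj_on c {1..m}" and XN: "?X \<subseteq> N"
    using cyc by (auto simp: is_cycle_def)
  have ne: "c 1 \<noteq> c 2"
    using inj m by (auto dest: inj_onD)
  have e1: "cycle_edge m c 1 = {c 1, c 2}" and e2: "cycle_edge m c 2 = {c 2, c 3}"
    using m cycle_edge_1[OF cyc] by (auto simp: cycle_edge_def)
  have "{c 1, c 2} \<in> E" "{c 2, c 3} \<in> E"
    using cycle_edge_in[OF cyc, of 1, unfolded e1] cycle_edge_in[OF cyc, of 2, unfolded e2] m
    by simp_all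
  then have "same_block E w ?X (c 2) (c 3)"
    using m less unfolding e1 e2
    by (intro same_block_edge[OF cycle_connected[OF cyc], of "{c 1, c 2}"]) auto
  moreover have "same_block E w ?X (c 1) (c 3)"
    using same_block_cycle[OF cyc, of 3] m M by simp
  ultimately have "same_block E w ?X (c 1) (c 2)"
    by (meson same_block_sym same_block_trans)
  moreover have "same_block E w (insert (c 1) T) (c 1) (c 2)"
    using same_block_first_edge[OF cyc T(2-4) _ we] cT by auto
  ultimately have "same_block E w (?X \<inter> insert (c 1) T) (c 1) (c 2)"
    using XN T(1) m by (intro same_block_Int) auto
  moreover have "?X \<inter> insert (c 1) T = {c 1, c 2}"
    using cT m by auto
  ultimately show False
    using not_same_block_pair[OF ne] by simp
qed

text \<open>Here \<open>T\<close> is one side of the path cut at \<open>c 2\<close>. The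
  alternatives in \<open>eT\<close> lead to different contradictions: one in a three-vertex set, the
  other in a set avoiding \<open>c 2\<close>.\<close>

lemma pan_chords:
  assumes cyc: "is_cycle N E m c" and j: "3 \<le> j" "j \<le> m"
    and T: "T \<subseteq> N" "c 2 \<notin> T" "connected_set E T" "e \<in> E" "e \<subseteq> insert (c 2) T"
    and q: "q \<in> T" "{c 2, q} \<in> E" and eT: "e = {c 2, q} \<or> e \<subseteq> T"
    and cT: "c ` {1..m} \<inter> T = {}"
    and we: "w e < w (cycle_edge m c 1)"
    and w12: "w (cycle_edge m c 1) \<le> w (cycle_edge m c 2)"
    and M: "\<And>k. k \<in> {3..m} \<Longrightarrow> w (cycle_edge m c 1) < w (cycle_edge m c k)"
  shows "{c j, c 2} \<in> E"
proof (rule ccontr)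
  let ?X = "c ` {1..m}"
  let ?R = "insert (c 1) (insert (c j) (insert (c 2) T))"
  assume nadj: "{c j, c 2} \<notin> E"
  have m: "3 \<le> m" and inj: "inj_on c {1..m}" and XN: "?X \<subseteq> N"
    using cyc by (auto simp: is_cycle_def)
  have ne: "c 1 \<noteq> c j" "c j \<noteq> c 2"
    using inj j by (auto dest: inj_onD)
  have cj: "c j \<in> ?X" "c 1 \<in> ?X" "c 2 \<in> ?X"
    using j by auto
  have e1: "cycle_edge m c 1 = {c 1, c 2}"
    by (rule cycle_edge_1[OF cyc])
  have all: "w e < w (cycle_edge m c k)" if "k \<in> {1..m}" for k
  proof -
    have "k = 1 \<or> k = 2 \<or> k \<in> {3..m}"
      using that by auto
    then show ?thesis
      using we w12 M by force
  qed
  \<comment> \<open>The set \<open>U\<close> will be \<open>insert (c 2) T\<close> for the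
    equivalence in \<open>?R\<close>, and the edge \<open>e\<close> itself when \<open>e\<close>
    ends at \<open>c 2\<close>.\<close>
  have block: "same_block E w (insert (c j) U) (c j) (c 2)"
    if "U \<subseteq> insert (c 2) T" "c 2 \<in> U" "connected_set E U" "e \<subseteq> U" for U
  proof (rule same_block_cycle_vertex[OF cyc _ j(2) _ that(3) T(4) that(4) _ all])
    show "U \<subseteq> N" "?X \<inter> U = {c 2}"
      using that(1,2) T(1) XN cT cj by blast+
  qed (use j in simp)
  have T2: "connected_set E (insert (c 2) T)"
    using connected_set_Un[OF connected_set_edge[OF q(2)] T(3), of q] q(1)
    by (simp add: insert_absorb)
  have RN: "?R \<subseteq> N"
    using T(1) XN cj by auto
  have "same_block E w (insert (c 1) (insert (c 2) T)) (c 1) (c 2)"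
    using same_block_first_edge[OF cyc T2 T(4,5) _ we] by simp
  then have R1: "same_block E w ?R (c 1) (c 2)"
    by (rule same_block_mono[OF _ _ RN]) auto
  have "same_block E w (insert (c j) (insert (c 2) T)) (c j) (c 2)"
    using block[OF _ _ T2 T(5)] by simp
  then have "same_block E w ?R (c j) (c 2)"
    by (rule same_block_mono[OF _ _ RN]) auto
  then have "same_block E w ?R (c 1) (c j)"
    using R1 by (meson same_block_sym same_block_trans)
  then have "same_block E w (?X \<inter> ?R) (c 1) (c j)"
    using same_block_cycle[OF cyc j M] XN RN by (intro same_block_Int)
  moreover have "?X \<inter> ?R = {c 1, c j, c 2}"
    using cT cj by auto
  ultimately have small: "same_block E w {c j, c 1, c 2} (c j) (c 1)"
    by (metis insert_commute same_block_sym)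
  \<comment> \<open>As \<open>c j\<close> is not linked to \<open>c 2\<close>, the vertex
    \<open>z\<close> is \<open>c 1\<close> and the lighter edge \<open>g\<close> is the first cycle
    edge. This puts the weight of \<open>{c j, c 1}\<close> above that of \<open>e\<close>.\<close>
  then obtain z g where z: "{c j, z} \<in> E" "z \<in> {c j, c 1, c 2}" "g \<in> E" "g \<subseteq> {c j, c 1, c 2}"
    "w g < w {c j, z}"
    using ne(1) by (metis same_block_leaving_edge)
  then have "z = c 1"
    using nadj no_loop by auto
  moreover have "g \<noteq> {c j, c 2}"
    using nadj z(3) by auto
  ultimately have "g = {c 1, c 2}" and jE: "{c j, c 1} \<in> E"
    using z edge_eq[OF z(3,4)] by auto
  then have heavy: "w e < w {c j, c 1}"
    using we z(5) \<open>z = c 1\<close> unfolding e1 by simp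
  show False
  proof (cases "e = {c 2, q}")
    case True
    \<comment> \<open>With \<open>U = e\<close>, only \<open>q\<close> is left to connect
      \<open>c j\<close> to \<open>c 2\<close>.\<close>
    then have "same_block E w {c j, q, c 2} (c j) (c 2)"
      using block[of e] q T(4) connected_set_edge[OF q(2)] by (auto simp: insert_commute)
    then show False
      using not_same_block_two_edge_path[OF ne(2) nadj] by simp
  next
    case False
    then have "e \<subseteq> T"
      using eT by simp
    obtain r where r: "r \<in> T" "{c j, r} \<in> E"
      using pan_linked[OF cyc j _ T2 T(4,5) _ all] T(1) XN cT cj nadj by auto
    \<comment> \<open>Connectedness comes through \<open>r\<close> instead of \<open>c 2\<close>,
      and \<open>e\<close> in \<open>T\<close> is lighter than \<open>{c j, c 1}\<close>. Avoiding
      \<open>c 2\<close> makes the intersection below shrink to \<open>{c j, c 1}\<close>.\<close>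
    let ?Y = "({c j, c 1} \<union> {c j, r}) \<union> T"
    have "connected_set E ?Y"
      by (rule connected_set_Un[OF connected_set_Un[OF connected_set_edge[OF jE]
            connected_set_edge[OF r(2)], of "c j"] T(3), of r]) (use r in auto)
    then have "same_block E w ?Y (c j) (c 1)"
      using \<open>e \<subseteq> T\<close> jE heavy by (intro same_block_edge[OF _ T(4)]) auto
    then have "same_block E w (?Y \<inter> {c j, c 1, c 2}) (c j) (c 1)"
      using small r T(1) XN cj by (intro same_block_Int) auto
    moreover have "?Y \<inter> {c j, c 1, c 2} = {c j, c 1}"
      using r cT cj T(2) inj j by (auto dest: inj_onD)
    ultimately show False
      using not_same_block_pair ne(1) by auto
  qed
qed

end

theorem proposition10:
  fixes N :: "'a set" and E :: "'a set set" and w :: "'a set \<Rightarrow> real"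
  assumes "fin_simple_graph N E"
    and "\<And>S. S \<noteq> {} \<Longrightarrow> S \<subseteq> N \<Longrightarrow>
      convex_game N (restricted_game (P_min_tilde E w) (unanimity_game S))"
  shows "reinforced_pan_condition N E w"
proof -
  interpret convexity_inheriting_graph N E w
    using assms by unfold_locales
  show ?thesis
    unfolding reinforced_pan_condition_def
  proof (intro allI impI conjI)
    fix m c p e M w1 w2
    assume cyc: "is_cycle N E m c" and m: "4 \<le> m"
      and w1: "w1 = w (cycle_edge m c 1)" and w2: "w2 = w (cycle_edge m c 2)"
      and w12: "w1 \<le> w2" and w2M: "w2 \<le> M"
      and M: "\<forall>k\<in>{3..m}. w (cycle_edge m c k) = M"
      and p: "is_path N E p" and e: "e \<in> path_edges p"
      and cp: "c ` {1..m} \<inter> set p = {c 2}"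
    have pN: "set p \<subseteq> N" and eE: "e \<in> E"
      using p e by (auto simp: is_path_def)
    have ep: "e \<subseteq> set p"
      using e by (auto simp: path_edges_def)
    \<comment> \<open>The list \<open>p\<close> is nonempty, so the truncated subtraction yields its
      last index.\<close>
    have "{0..length p - 1} = {..<length p}"
      using p by (cases p) (auto simp: is_path_def)
    then have "set p = (!) p ` {0..length p - 1}"
      by (auto simp: set_conv_nth)
    moreover have "connected_set E ((!) p ` {0..length p - 1})"
    proof (rule connected_set_interval)
      fix k assume "0 \<le> k" "k < length p - 1"
      then have "{p ! k, p ! Suc k} \<in> path_edges p"
        unfolding path_edges_def by auto
      then show "{p ! k, p ! Suc k} \<in> E"
        using p by (auto simp: is_path_def)
    qed
    ultimately have pc: "connected_set E (set p)"
      by simp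
    {
      fix k assume "k \<in> {1..m}"
      then have "k = 1 \<or> k = 2 \<or> k \<in> {3..m}"
        by auto
      \<comment> \<open>The first edge is a lightest edge of the cycle, so \<open>w e < w1\<close>
        makes \<open>e\<close> lighter than all of them.\<close>
      then have "w1 \<le> w (cycle_edge m c k)"
        using w1 w2 w12 w2M M by force
    }
    note w1_le = this
    show "\<forall>j\<in>{4..m}. \<exists>x\<in>set p. {c j, x} \<in> E" if "w e < w1"
    proof
      fix j assume "j \<in> {4..m}"
      then have "3 \<le> j" "j \<le> m"
        by auto
      then show "\<exists>x\<in>set p. {c j, x} \<in> E"
        by (rule pan_linked[OF cyc _ _ pN pc eE ep cp]) (use w1_le that in force)
    qed
    assume "w e < w1 \<and> w1 < M"
    then have we: "w e < w (cycle_edge m c 1)"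
      and M': "\<And>k. k \<in> {3..m} \<Longrightarrow> w (cycle_edge m c 1) < w (cycle_edge m c k)"
      using w1 M by auto
    note le = w12[unfolded w1 w2]
    show "w1 = w2"
      using pan_weights_eq[OF cyc pN pc eE ep cp we le M'] w1 w2 by simp
    have c2: "c 2 \<in> set p"
      using cp by auto
    \<comment> \<open>If \<open>e\<close> ends at \<open>c 2\<close>, its other end alone serves as
      \<open>T\<close>; otherwise \<open>T\<close> is the stretch of the path from a neighbour of
      \<open>c 2\<close> to \<open>e\<close>.\<close>
    obtain T q where T: "T \<subseteq> set p" "c 2 \<notin> T" "connected_set E T" "q \<in> T" "{c 2, q} \<in> E"
      and eT: "e = {c 2, q} \<or> e \<subseteq> T"
    proof (cases "c 2 \<in> e")
      case True
      obtain a b where "e = {a, b}" "a \<noteq> b"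
        using eE graph by (metis card_2_iff fin_simple_graph_def)
      then have "e = {c 2, b} \<and> b \<noteq> c 2 \<or> e = {c 2, a} \<and> a \<noteq> c 2"
        using True by auto
      then obtain q where q: "e = {c 2, q}" "q \<noteq> c 2"
        by blast
      have "connected_set E {q}"
        by (simp add: connected_set_def connected_in_def)
      then show thesis
        using q eE ep by (intro that[of "{q}" q]) auto
    next
      case False
      then show thesis
        using path_connected_part[OF p e c2] that by metis
    qed
    have "T \<subseteq> N"
      using T(1) pN by (rule subset_trans)
    moreover have "c ` {1..m} \<inter> T \<subseteq> {c 2}"
      using T(1) by (subst cp[symmetric]) (rule Int_mono[OF subset_refl])
    then have "c ` {1..m} \<inter> T = {}"
      using T(2) by (metis Int_iff insertI1 subset_singletonD)
    moreover have "e \<subseteq> insert (c 2) T"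
      using T(4) eT by auto
    ultimately show "\<forall>j\<in>{4..m}. {c j, c 2} \<in> E"
      using pan_chords[OF cyc _ _ _ T(2,3) eE _ T(4,5) eT _ we le M'] by auto
  qed
qed

end
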